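(* Let $v_0\ge0$ and $v_1\ge0$, at least one of them different from zero. Then the function $$f(\delta)=\frac{(v_1+v_0)(\delta-\sin\delta)-2\sqrt{v_1v_0}\left(\delta\cos\frac\delta2-2\sin\frac\delta2\right)}{2\sin^2\frac\delta2}$$ is strictly increasing and convex on the interval $(0,2\pi)$. Moreover, it maps $(0,2\pi)$ onto $(0,\infty)$. *)

theory Defs
  imports "HOL-Analysis.Analysis"
begin

definition f :: "real \<Rightarrow> real \<Rightarrow> real \<Rightarrow> real" where
  "f v0 v1 \<delta> =
     ((v1 + v0) * (\<delta> - sin \<delta>)
        - 2 * sqrt (v1 * v0) * (\<delta> * cos (\<delta> / 2) - 2 * sin (\<delta> / 2)))
     / (2 * (sin (\<delta> / 2))\<^sup>2)"

end

theory Submission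
  imports Defs "HOL-Real_Asymp.Real_Asymp"
begin

text \<open>
  Put \<open>x = \<delta> / 2\<close> and \<open>w = 2 * sqrt (v1 * v0)\<close>. Then \<open>f v0 v1 \<delta> = (v0 + v1 - w) * g x + w * h x\<close>
  with \<open>g x = (x - sin x * cos x) / (sin x)\<^sup>2\<close> and \<open>h x = (x + sin x) / (1 + cos x)\<close>, and both
  weights are nonnegative by AM-GM. So it suffices that \<open>g\<close> and \<open>h\<close> have positive increasing
  derivatives on \<open>(0, pi)\<close>. For \<open>g\<close> this reduces to \<open>x * (1 + 2 * (cos x)\<^sup>2) \<ge> 3 * sin x * cos x\<close>;
  for \<open>h\<close> it follows from \<open>h' x = 1 + h x * tan (x / 2)\<close>.
\<close>

section \<open>Two trigonometric inequalities on (0, pi)\<close>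

lemma x_cos_less_sin:
  fixes x :: real
  assumes "0 < x" "x < pi"
  shows "x * cos x < sin x"
proof -
  have "sin 0 - 0 * cos 0 < sin x - x * cos x"
  proof (rule DERIV_pos_imp_increasing_open[OF assms(1)])
    fix y :: real assume y: "0 < y" "y < x"
    \<comment> \<open>The two copies of \<open>cos y\<close> cancel, which leaves a derivative of
      obvious sign.\<close>
    have "((\<lambda>x. sin x - x * cos x) has_real_derivative y * sin y) (at y)"
      by (auto intro!: derivative_eq_intros)
    moreover have "y * sin y > 0" using y assms by (simp add: sin_gt_zero)
    ultimately show "\<exists>d. ((\<lambda>x. sin x - x * cos x) has_real_derivative d) (at y) \<and> d > 0" by blast
  qed (auto intro!: continuous_intros)
  then show ?thesis by simp
qed

text \<open>The difference of the two sides vanishes at 0, and by the Pythagorean identity its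
  derivative is 4 sin y (sin y - y cos y), which is nonnegative by \<open>x_cos_less_sin\<close>. Up
  to a positive factor this difference is the second derivative of \<open>g\<close>.\<close>

lemma three_sin_cos_le:
  fixes x :: real
  assumes "0 < x" "x < pi"
  shows "3 * sin x * cos x \<le> x * (1 + 2 * (cos x)\<^sup>2)"
proof -
  let ?p = "\<lambda>x::real. x * (1 + 2 * (cos x)\<^sup>2) - 3 * sin x * cos x"
  have "?p 0 \<le> ?p x"
  proof (rule DERIV_nonneg_imp_increasing_open[of 0 x ?p])
    fix y :: real assume y: "0 < y" "y < x"
    have "(?p has_real_derivative 4 * sin y * (sin y - y * cos y)) (at y)"
      by (auto intro!: derivative_eq_intros)
         (use sin_cos_squared_add[of y] in algebra)
    moreover have "4 * sin y * (sin y - y * cos y) \<ge> 0"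
      using x_cos_less_sin[of y] sin_gt_zero[of y] y assms by simp
    ultimately show "\<exists>d. (?p has_real_derivative d) (at y) \<and> d \<ge> 0" by blast
  qed (use assms in \<open>auto intro!: continuous_intros\<close>)
  then show ?thesis by simp
qed

text \<open>The two extreme cases of \<open>f\<close>: on (0, pi), \<open>g x\<close> is
  \<open>f 1 0 (2 * x)\<close>, and \<open>2 * h x\<close> is \<open>f 1 1 (2 * x)\<close>.\<close>

definition g :: "real \<Rightarrow> real" where
  "g x = (x - sin x * cos x) / (sin x)\<^sup>2"

definition g' :: "real \<Rightarrow> real" where
  "g' x = 2 * (sin x - x * cos x) / sin x ^ 3"

definition h :: "real \<Rightarrow> real" where
  "h x = (x + sin x) / (1 + cos x)"

text \<open>Compared with the raw quotient rule, this form shows positivity at once and yields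
  monotonicity without a second derivative.\<close>

definition h' :: "real \<Rightarrow> real" where
  "h' x = 1 + h x * (sin x / (1 + cos x))"

section \<open>Sign and monotonicity of the derivatives\<close>

lemma one_plus_cos_pos:
  fixes x :: real
  assumes "0 < x" "x < pi"
  shows "1 + cos x > 0"
  using cos_monotone_0_pi[of x pi] assms by simp

lemma has_real_derivative_g:
  assumes "0 < x" "x < pi"
  shows "(g has_real_derivative g' x) (at x)"
proof -
  have s: "sin x \<noteq> 0" using sin_gt_zero[OF assms] by simp
  have "((\<lambda>x. (x - sin x * cos x) / (sin x)\<^sup>2) has_real_derivative
     ((1 - (cos x * cos x - sin x * sin x)) * (sin x)\<^sup>2
       - (x - sin x * cos x) * (2 * sin x * cos x)) / ((sin x)\<^sup>2 * (sin x)\<^sup>2)) (at x)"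
    using s by (auto intro!: derivative_eq_intros)
  also have "((1 - (cos x * cos x - sin x * sin x)) * (sin x)\<^sup>2
       - (x - sin x * cos x) * (2 * sin x * cos x)) = 2 * (sin x - x * cos x) * sin x"
    using sin_cos_squared_add[of x] by algebra
  also have "\<dots> / ((sin x)\<^sup>2 * (sin x)\<^sup>2) = g' x"
    using s by (simp add: g'_def power2_eq_square power3_eq_cube)
  finally show ?thesis by (simp add: g_def[abs_def])
qed

lemma has_real_derivative_h:
  assumes "0 < x" "x < pi"
  shows "(h has_real_derivative h' x) (at x)"
proof -
  have c: "1 + cos x \<noteq> 0" using one_plus_cos_pos[OF assms] by simp
  have "((\<lambda>x. (x + sin x) / (1 + cos x)) has_real_derivative
     ((1 + cos x) * (1 + cos x) + (x + sin x) * sin x) / ((1 + cos x) * (1 + cos x))) (at x)"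
    using c by (auto intro!: derivative_eq_intros)
  also have "((1 + cos x) * (1 + cos x) + (x + sin x) * sin x) / ((1 + cos x) * (1 + cos x)) = h' x"
    unfolding h'_def h_def add_divide_distrib[of "(1 + cos x) * (1 + cos x)"] times_divide_times_eq
    using c by simp
  finally show ?thesis by (simp add: h_def[abs_def])
qed

lemma g'_pos: "0 < x \<Longrightarrow> x < pi \<Longrightarrow> g' x > 0"
  using x_cos_less_sin[of x] sin_gt_zero[of x] by (simp add: g'_def)

lemma h_pos: "0 < x \<Longrightarrow> x < pi \<Longrightarrow> h x > 0"
  using one_plus_cos_pos[of x] sin_gt_zero[of x] by (simp add: h_def)

lemma h'_pos: "0 < x \<Longrightarrow> x < pi \<Longrightarrow> h' x > 0"
  using h_pos[of x] one_plus_cos_pos[of x] sin_gt_zero[of x]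
  by (auto simp: h'_def intro!: add_pos_nonneg mult_nonneg_nonneg divide_nonneg_nonneg)

lemma g'_mono:
  assumes "0 < x" "x \<le> y" "y < pi"
  shows "g' x \<le> g' y"
proof (rule DERIV_nonneg_imp_nondecreasing[OF assms(2)])
  fix z assume "x \<le> z" "z \<le> y"
  with assms have z: "0 < z" "z < pi" by auto
  have s: "sin z > 0" using sin_gt_zero[OF z] .
  \<comment> \<open>The second derivative of \<open>g\<close>: the quotient rule gives the
    denominator sin^6, from which a factor sin^2 cancels.\<close>
  let ?d = "2 * (z * (1 + 2 * (cos z)\<^sup>2) - 3 * sin z * cos z) / sin z ^ 4"
  have "((\<lambda>x. 2 * (sin x - x * cos x) / sin x ^ 3) has_real_derivative
     (2 * (z * sin z) * sin z ^ 3 - 2 * (sin z - z * cos z) * (3 * (sin z)\<^sup>2 * cos z))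
       / (sin z ^ 3 * sin z ^ 3)) (at z)"
    using s by (auto intro!: derivative_eq_intros)
  also have "2 * (z * sin z) * sin z ^ 3 - 2 * (sin z - z * cos z) * (3 * (sin z)\<^sup>2 * cos z)
      = 2 * (z * (1 + 2 * (cos z)\<^sup>2) - 3 * sin z * cos z) * (sin z)\<^sup>2"
    using sin_cos_squared_add[of z] by algebra
  also have "\<dots> / (sin z ^ 3 * sin z ^ 3) = ?d"
    using s by (simp add: divide_simps)
  finally have "(g' has_real_derivative ?d) (at z)" by (simp add: g'_def[abs_def])
  moreover have "?d \<ge> 0" using three_sin_cos_le[OF z] s by (intro divide_nonneg_nonneg mult_nonneg_nonneg) simp_all
  ultimately show "\<exists>d. (g' has_real_derivative d) (at z) \<and> d \<ge> 0" by blast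
qed

lemma h_mono:
  assumes "0 < x" "x \<le> y" "y < pi"
  shows "h x \<le> h y"
proof (rule DERIV_nonneg_imp_nondecreasing[OF assms(2)])
  fix z assume "x \<le> z" "z \<le> y"
  with assms have "0 < z" "z < pi" by auto
  then show "\<exists>d. (h has_real_derivative d) (at z) \<and> d \<ge> 0"
    using has_real_derivative_h h'_pos less_imp_le by blast
qed

text \<open>Both factors of the product in \<open>h'\<close> are nonnegative and increasing:
  \<open>h\<close> by \<open>h_mono\<close>, and sin x / (1 + cos x) because it equals tan (x /
  2).\<close>

lemma h'_mono:
  assumes "0 < x" "x \<le> y" "y < pi"
  shows "h' x \<le> h' y"
proof -
  have xy: "x < pi" "0 < y" using assms by auto
  have "sin x / (1 + cos x) \<le> sin y / (1 + cos y)"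
  proof -
    have t: "sin z / (1 + cos z) = tan (z / 2)" for z :: real
      using tan_half[of "z / 2"] by (simp add: add.commute)
    have "tan (x / 2) \<le> tan (y / 2)"
      by (rule tan_mono_le) (use assms in auto)
    then show ?thesis by (simp add: t)
  qed
  then have "h x * (sin x / (1 + cos x)) \<le> h y * (sin y / (1 + cos y))"
    using h_mono[OF assms] h_pos[OF xy(2) assms(3)]
      one_plus_cos_pos[OF assms(1) xy(1)] sin_gt_zero[OF assms(1) xy(1)]
    by (intro mult_mono) auto
  then show ?thesis by (simp add: h'_def)
qed

text \<open>Multiply by sin^2. Since sin^2 = (1 + cos)(1 - cos), all denominators disappear, and the
  identity reduces to (x + sin x)(1 - cos x) - (x - sin x cos x) = sin x - x cos x.\<close>

lemma f_eq_g_h: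
  assumes "0 < x" "x < pi"
  shows "f v0 v1 (2 * x) = (v0 + v1 - 2 * sqrt (v1 * v0)) * g x + 2 * sqrt (v1 * v0) * h x"
proof -
  have s: "sin x \<noteq> 0" using sin_gt_zero[OF assms] by simp
  have c: "1 + cos x \<noteq> 0" using one_plus_cos_pos[OF assms] by simp
  have "h x * (sin x)\<^sup>2 = (x + sin x) * (1 - cos x)"
  proof -
    have "(sin x)\<^sup>2 = (1 + cos x) * (1 - cos x)"
      using sin_cos_squared_add[of x] by algebra
    then show ?thesis using c by (simp add: h_def)
  qed
  moreover have "g x * (sin x)\<^sup>2 = x - sin x * cos x" using s by (simp add: g_def)
  moreover have "f v0 v1 (2 * x) * (sin x)\<^sup>2
      = (v1 + v0) * (x - sin x * cos x) - 2 * sqrt (v1 * v0) * (x * cos x - sin x)"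
  proof -
    have "f v0 v1 (2 * x) = ((v1 + v0) * (2 * x - sin (2 * x))
        - 2 * sqrt (v1 * v0) * (2 * x * cos x - 2 * sin x)) / (2 * (sin x)\<^sup>2)"
      by (simp add: f_def)
    also have "\<dots> * (sin x)\<^sup>2 = ((v1 + v0) * (2 * x - sin (2 * x))
        - 2 * sqrt (v1 * v0) * (2 * x * cos x - 2 * sin x)) / 2"
      using s by simp
    also have "\<dots> = (v1 + v0) * (x - sin x * cos x) - 2 * sqrt (v1 * v0) * (x * cos x - sin x)"
      unfolding sin_double by (simp add: field_simps)
    finally show ?thesis .
  qed
  ultimately have "f v0 v1 (2 * x) * (sin x)\<^sup>2
      = ((v0 + v1 - 2 * sqrt (v1 * v0)) * g x + 2 * sqrt (v1 * v0) * h x) * (sin x)\<^sup>2"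
    by algebra
  then show ?thesis using s by simp
qed

section \<open>Behaviour at the ends of the interval\<close>

lemma f_tendsto_0: "(f v0 v1 \<longlongrightarrow> 0) (at_right 0)"
proof -
  \<comment> \<open>Both numerators vanish to third order at 0, the denominator only to second
    order.\<close>
  have 1: "((\<lambda>d::real. (d - sin d) / (2 * (sin (d / 2))\<^sup>2)) \<longlongrightarrow> 0) (at_right 0)"
    by real_asymp
  have 2: "((\<lambda>d::real. (d * cos (d / 2) - 2 * sin (d / 2)) / (2 * (sin (d / 2))\<^sup>2)) \<longlongrightarrow> 0) (at_right 0)"
    by real_asymp
  have "f v0 v1 = (\<lambda>d. (v1 + v0) * ((d - sin d) / (2 * (sin (d / 2))\<^sup>2))
      - 2 * sqrt (v1 * v0) * ((d * cos (d / 2) - 2 * sin (d / 2)) / (2 * (sin (d / 2))\<^sup>2)))"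
    by (simp only: fun_eq_iff f_def diff_divide_distrib times_divide_eq_right right_diff_distrib) simp
  then show ?thesis
    using tendsto_diff[OF tendsto_mult_left[OF 1, of "v1 + v0"]
        tendsto_mult_left[OF 2, of "2 * sqrt (v1 * v0)"]] by simp
qed

text \<open>The denominator tends to 0 through positive values, while the numerator has a limit that
  is positive because \<open>v0\<close> and \<open>v1\<close> are not both zero.\<close>

lemma f_at_top:
  assumes "v0 \<ge> 0" "v1 \<ge> 0" "v0 \<noteq> 0 \<or> v1 \<noteq> 0"
  shows "filterlim (f v0 v1) at_top (at_left (2 * pi))"
  unfolding f_def[abs_def]
proof (rule LIM_at_top_divide)
  let ?n = "\<lambda>\<delta>. (v1 + v0) * (\<delta> - sin \<delta>)
    - 2 * sqrt (v1 * v0) * (\<delta> * cos (\<delta> / 2) - 2 * sin (\<delta> / 2))"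
  have "(?n \<longlongrightarrow> ?n (2 * pi)) (at_left (2 * pi))"
    by (intro tendsto_intros) auto
  then show "(?n \<longlongrightarrow> 2 * pi * (v1 + v0 + 2 * sqrt (v1 * v0))) (at_left (2 * pi))"
    by (simp add: algebra_simps)
  have "v1 + v0 > 0" using assms by linarith
  then show "0 < 2 * pi * (v1 + v0 + 2 * sqrt (v1 * v0))"
    using assms by (simp add: add_pos_nonneg)
  have "((\<lambda>\<delta>. 2 * (sin (\<delta> / 2))\<^sup>2) \<longlongrightarrow> 2 * (sin (2 * pi / 2))\<^sup>2) (at_left (2 * pi))"
    by (intro tendsto_intros) auto
  then show "((\<lambda>\<delta>. 2 * (sin (\<delta> / 2))\<^sup>2) \<longlongrightarrow> 0) (at_left (2 * pi))"
    by simp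
  have "0 < 2 * (sin (\<delta> / 2))\<^sup>2" if "\<delta> \<in> {0<..<2 * pi}" for \<delta> :: real
    using sin_gt_zero[of "\<delta> / 2"] that by simp
  then show "\<forall>\<^sub>F \<delta> in at_left (2 * pi). 0 < 2 * (sin (\<delta> / 2))\<^sup>2"
    using eventually_at_left_real[of 0 "2 * pi"] by (auto elim: eventually_mono)
qed

theorem lemma10:
  fixes v0 v1 :: real
  assumes "v0 \<ge> 0" and "v1 \<ge> 0" and "v0 \<noteq> 0 \<or> v1 \<noteq> 0"
  shows "strict_mono_on {0<..<2 * pi} (f v0 v1)
       \<and> convex_on {0<..<2 * pi} (f v0 v1)
       \<and> f v0 v1 ` {0<..<2 * pi} = {0<..}"
proof -
  let ?I = "{0<..<2 * pi}"
  define w where "w = 2 * sqrt (v1 * v0)"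
  define f' where "f' \<delta> = ((v0 + v1 - w) * g' (\<delta> / 2) + w * h' (\<delta> / 2)) / 2" for \<delta>
  have w: "w \<ge> 0" "v0 + v1 - w \<ge> 0"
    using assms arith_geo_mean_sqrt[of v1 v0] by (auto simp: w_def)
  have deriv: "(f v0 v1 has_real_derivative f' \<delta>) (at \<delta>)" if \<delta>: "\<delta> \<in> ?I" for \<delta>
  proof -
    have "((\<lambda>\<delta>. (v0 + v1 - w) * g (\<delta> / 2) + w * h (\<delta> / 2)) has_real_derivative f' \<delta>) (at \<delta>)"
    proof -
      have "((\<lambda>\<delta>. g (\<delta> / 2)) has_real_derivative g' (\<delta> / 2) * (1 / 2)) (at \<delta>)"
        using \<delta> by (intro DERIV_chain2[OF has_real_derivative_g])
          (auto intro!: derivative_eq_intros)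
      moreover have "((\<lambda>\<delta>. h (\<delta> / 2)) has_real_derivative h' (\<delta> / 2) * (1 / 2)) (at \<delta>)"
        using \<delta> by (intro DERIV_chain2[OF has_real_derivative_h])
          (auto intro!: derivative_eq_intros)
      ultimately have "((\<lambda>\<delta>. (v0 + v1 - w) * g (\<delta> / 2) + w * h (\<delta> / 2)) has_real_derivative
          (v0 + v1 - w) * (g' (\<delta> / 2) * (1 / 2)) + w * (h' (\<delta> / 2) * (1 / 2))) (at \<delta>)"
        by (intro DERIV_add DERIV_cmult)
      then show ?thesis by (rule DERIV_cong) (simp add: f'_def field_simps)
    qed
    \<comment> \<open>Agreement on an open set containing \<delta> is enough to transfer the
      derivative.\<close>
    moreover have "(v0 + v1 - w) * g (x / 2) + w * h (x / 2) = f v0 v1 x" if "x \<in> ?I" for x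
      using f_eq_g_h[of "x / 2" v0 v1] that by (simp add: w_def)
    ultimately show ?thesis
      by (rule has_field_derivative_transform_within_open[OF _ open_greaterThanLessThan \<delta>])
  qed
  have f'_pos: "f' \<delta> > 0" if "\<delta> \<in> ?I" for \<delta>
  \<comment> \<open>Either weight may vanish, but not both: if \<open>w = 0\<close>, the weight of
    \<open>g'\<close> is v0 + v1 > 0; otherwise the \<open>h'\<close> term is strictly
    positive.\<close>
  proof (cases "w = 0")
    case True
    moreover have "v0 + v1 > 0" using assms by linarith
    ultimately show ?thesis using g'_pos[of "\<delta> / 2"] that by (simp add: f'_def)
  next
    case False
    then show ?thesis using w g'_pos[of "\<delta> / 2"] h'_pos[of "\<delta> / 2"] that
      by (auto simp: f'_def intro!: add_nonneg_pos)
  qed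
  have mono: "strict_mono_on ?I (f v0 v1)"
  proof (rule strict_mono_onI)
    fix x y :: real assume "x \<in> ?I" "y \<in> ?I" "x < y"
    then show "f v0 v1 x < f v0 v1 y"
      using deriv f'_pos by (intro DERIV_pos_imp_increasing[of x y "f v0 v1"]) force+
  qed
  have "convex_on ?I (f v0 v1)"
  proof (rule convex_on_realI[OF _ deriv])
    fix x y :: real assume "x \<in> ?I" "y \<in> ?I" "x \<le> y"
    then show "f' x \<le> f' y"
      using w g'_mono[of "x / 2" "y / 2"] h'_mono[of "x / 2" "y / 2"]
      by (auto simp: f'_def intro!: divide_right_mono add_mono mult_left_mono)
  qed auto
  moreover have "f v0 v1 ` ?I = {0<..}"
  proof (intro equalityI subsetI)
    fix y assume "y \<in> f v0 v1 ` ?I"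
    then obtain x where x: "x \<in> ?I" "y = f v0 v1 x" by blast
    \<comment> \<open>The limit at 0 gives only a weak bound, so it is applied at x / 2; strict
      monotonicity from x / 2 to x then makes it strict.\<close>
    have "f v0 v1 (x / 2) \<ge> 0"
    proof (rule tendsto_upperbound[OF f_tendsto_0])
      have "\<forall>\<^sub>F z in at_right 0. z \<in> {0<..<x / 2}"
        using x by (intro eventually_at_right_real) auto
      then show "\<forall>\<^sub>F z in at_right 0. f v0 v1 z \<le> f v0 v1 (x / 2)"
        by eventually_elim (use x in \<open>auto intro!: less_imp_le strict_mono_onD[OF mono]\<close>)
    qed auto
    moreover have "f v0 v1 (x / 2) < f v0 v1 x"
      using x by (intro strict_mono_onD[OF mono]) auto
    ultimately show "y \<in> {0<..}" using x by simp
  next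
    fix y :: real assume y: "y \<in> {0<..}"
    have "\<forall>\<^sub>F x in at_right 0. f v0 v1 x < y \<and> x \<in> ?I"
    proof (rule eventually_conj)
      show "\<forall>\<^sub>F x in at_right 0. f v0 v1 x < y"
        using order_tendstoD(2)[OF f_tendsto_0] y by simp
      show "\<forall>\<^sub>F x in at_right 0. x \<in> ?I"
        by (rule eventually_at_right_real) simp
    qed
    then obtain a where a: "f v0 v1 a < y" "a \<in> ?I"
      using eventually_happens trivial_limit_at_right_real by blast
    \<comment> \<open>The right end \<open>b\<close> is sought beyond \<open>a\<close>, so that the
      intermediate value theorem applies on [a, b].\<close>
    have "\<forall>\<^sub>F x in at_left (2 * pi). y \<le> f v0 v1 x \<and> x \<in> {a<..<2 * pi}"
    proof (rule eventually_conj)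
      show "\<forall>\<^sub>F x in at_left (2 * pi). y \<le> f v0 v1 x"
        using f_at_top[OF assms] unfolding filterlim_at_top by blast
      show "\<forall>\<^sub>F x in at_left (2 * pi). x \<in> {a<..<2 * pi}"
        by (rule eventually_at_left_real) (use a in simp)
    qed
    then obtain b where b: "y \<le> f v0 v1 b" "b \<in> {a<..<2 * pi}"
      using eventually_happens trivial_limit_at_left_real by blast
    have "continuous_on {a..b} (f v0 v1)"
    proof (rule DERIV_continuous_on)
      fix x assume "x \<in> {a..b}"
      with a b have "x \<in> ?I" by auto
      then show "(f v0 v1 has_real_derivative f' x) (at x within {a..b})"
        by (rule has_field_derivative_at_within[OF deriv])
    qed
    then obtain x where "a \<le> x" "x \<le> b" "f v0 v1 x = y"
      using IVT'[of "f v0 v1" a y b] a b by auto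
    then show "y \<in> f v0 v1 ` ?I" using a b by force
  qed
  ultimately show ?thesis using mono by blast
qed

end
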